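(* Let $\phi=\frac12(1+\sqrt5)$ and let $G=(V,E)$ be a graph. We have $\mu(G)\ge\phi$ if any of the following holds (where, for a function $h:V\to\mathbb R$, the objects $m$, $M$ and $Q=qm$ are defined from $h$ as in the context). (a) $G\in\mathcal Q_3$ and there exists a harmonic function $h:V\to\mathbb R$ such that, for all $u\in V$, $$M_{m(u)}-M_u<\min\{M_u,\,M_{Q(u)}\},\qquad 2M_{Q(u)}>M_{m(u)}-M_u+M_{m(Q(u))}.$$ (b) $G\in\mathcal G_3$ has a transitive graph height function. (c) $G\in\mathcal Q_3$ has girth $g\ge3$, and there exists a function $h:V\to\mathbb R$ such that, for all $u\in V$, $$h(Q(u))>h(u),\qquad h(m(Q(u)))>h(m(u)),\qquad h(Q^{\gamma+1}(u))>h(m(u)),$$ where $\gamma=\lceil\frac12(g-1)\rceil$. (d) $G\in\mathcal Q_3$ has girth $g\ge3$, and there exists a harmonic function $h:V\to\mathbb R$ such that, for all $u\in V$, $$M_{m(u)}-M_u<\min\{M_u,\,M_{Q(u)}\},\qquad h(Q^{\gamma+1}(u))>h(m(u)),$$ where $\gamma=\lceil\frac12(g-1)\rceil$.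
   Context: $\mathcal Q_3$ (respectively $\mathcal G_3$) is the set of infinite, rooted, connected, simple, quasi-transitive (respectively vertex-transitive) graphs in which every vertex has degree 3. Quasi-transitive means that $\mathrm{Aut}(G)$ has finitely many vertex orbits. A self-avoiding walk (SAW) is a walk with no repeated vertex; $\sigma_n(v)$ is the number of $n$-step SAWs from $v$, and $\mu(G)=\lim_{n\to\infty}\sigma_n(v)^{1/n}$ (the limit exists and is independent of $v$). A function $h:V\to\mathbb R$ is harmonic if $h(v)=\frac1{\deg(v)}\sum_{u\sim v}h(u)$ for all $v$. Given $h:V\to\mathbb R$ on a cubic graph, for each $u\in V$ fix once and for all a neighbour $m(u)\sim u$ that maximizes $h(x)-h(u)$ over neighbours $x$ of $u$, and let $M_u=h(m(u))-h(u)$. For $u\in V$, with $v=m(u)$, let $Q(u)$ (also written $qm(u)$) be the unique neighbour of $v$ other than $u$ and $m(v)$; conditions involving $Q$ are understood to include the requirement $m(m(u))\ne u$ for all $u$, so that $Q:V\to V$ is well defined. $Q^k$ is the $k$-fold iterate of $Q$. A graph height function on a graph $G=(V,E)$ with root $0$ is a pair $(h,\mathcal H)$ such that: $h:V\to\mathbb Z$ with $h(0)=0$; $\mathcal H\le\mathrm{Aut}(G)$ acts on $V$ with finitely many orbits and $h(\alpha v)-h(\alpha u)=h(v)-h(u)$ for all $\alpha\in\mathcal H$, $u,v\in V$; and every $v\in V$ has neighbours $u,w$ with $h(u)<h(v)<h(w)$. It is transitive if $\mathcal H$ acts transitively on $V$. *)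

theory Defs
  imports
    Complex_Main
    "HOL-Library.Extended_Nat"
    "HOL-Algebra.Group_Action"
begin

section \<open>Graphs\<close>

text \<open>A graph is given by its vertex set \<open>V\<close> and its set \<open>E\<close> of edges, each edge being a
  two-element set of vertices.\<close>

definition simple_graph :: "'a set \<Rightarrow> 'a set set \<Rightarrow> bool" where
  "simple_graph V E \<longleftrightarrow> (\<forall>e\<in>E. \<exists>u\<in>V. \<exists>v\<in>V. u \<noteq> v \<and> e = {u, v})"

definition adjacent :: "'a set set \<Rightarrow> 'a \<Rightarrow> 'a \<Rightarrow> bool" where
  "adjacent E u v \<longleftrightarrow> {u, v} \<in> E"

definition neighbours :: "'a set set \<Rightarrow> 'a \<Rightarrow> 'a set" where
  "neighbours E v = {u. adjacent E v u}"

definition connected_graph :: "'a set \<Rightarrow> 'a set set \<Rightarrow> bool" where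
  "connected_graph V E \<longleftrightarrow> (\<forall>u\<in>V. \<forall>v\<in>V. (adjacent E)\<^sup>*\<^sup>* u v)"

definition cubic :: "'a set \<Rightarrow> 'a set set \<Rightarrow> bool" where
  "cubic V E \<longleftrightarrow> (\<forall>v\<in>V. card (neighbours E v) = 3)"

text \<open>As in \<^const>\<open>BijGroup\<close>, automorphisms are extensional on \<open>V\<close>.\<close>

definition aut_group :: "'a set \<Rightarrow> 'a set set \<Rightarrow> ('a \<Rightarrow> 'a) monoid" where
  "aut_group V E = BijGroup V
     \<lparr>carrier := {\<alpha> \<in> Bij V. \<forall>u\<in>V. \<forall>v\<in>V. adjacent E (\<alpha> u) (\<alpha> v) \<longleftrightarrow> adjacent E u v}\<rparr>"

definition finitely_many_orbits :: "'a set \<Rightarrow> 'a set set \<Rightarrow> ('a \<Rightarrow> 'a) set \<Rightarrow> bool" where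
  "finitely_many_orbits V E H \<longleftrightarrow> finite (orbits (aut_group V E\<lparr>carrier := H\<rparr>) V (\<lambda>\<alpha>. \<alpha>))"

definition acts_transitively :: "'a set \<Rightarrow> ('a \<Rightarrow> 'a) set \<Rightarrow> bool" where
  "acts_transitively V H \<longleftrightarrow> (\<forall>u\<in>V. \<forall>v\<in>V. \<exists>\<alpha>\<in>H. \<alpha> u = v)"

text \<open>\<open>r\<close> is the root.\<close>

definition Q3 :: "'a set \<Rightarrow> 'a set set \<Rightarrow> 'a \<Rightarrow> bool" where
  "Q3 V E r \<longleftrightarrow> simple_graph V E \<and> r \<in> V \<and> infinite V \<and> connected_graph V E \<and> cubic V E
     \<and> finitely_many_orbits V E (carrier (aut_group V E))"

definition G3 :: "'a set \<Rightarrow> 'a set set \<Rightarrow> 'a \<Rightarrow> bool" where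
  "G3 V E r \<longleftrightarrow> simple_graph V E \<and> r \<in> V \<and> infinite V \<and> connected_graph V E \<and> cubic V E
     \<and> acts_transitively V (carrier (aut_group V E))"

definition is_cycle :: "'a set set \<Rightarrow> 'a list \<Rightarrow> bool" where
  "is_cycle E c \<longleftrightarrow>
     3 \<le> length c \<and> distinct c \<and> successively (adjacent E) c \<and> adjacent E (last c) (hd c)"

text \<open>The girth of a graph without cycles is \<open>\<infinity>\<close>.\<close>

definition girth :: "'a set set \<Rightarrow> enat" where
  "girth E = (INF c\<in>{c. is_cycle E c}. enat (length c))"


section \<open>Self-avoiding walks and the connective constant\<close>

text \<open>An \<open>n\<close>-step walk is the list of the \<open>n + 1\<close> vertices it visits.\<close>

definition saws :: "'a set set \<Rightarrow> 'a \<Rightarrow> nat \<Rightarrow> 'a list set" where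
  "saws E v n =
     {p. length p = n + 1 \<and> hd p = v \<and> successively (adjacent E) p \<and> distinct p}"

definition saw_count :: "'a set set \<Rightarrow> 'a \<Rightarrow> nat \<Rightarrow> nat" where
  "saw_count E v n = card (saws E v n)"

text \<open>The connective constant is the common limit, over all starting vertices, of the \<open>n\<close>-th
  roots of the numbers of \<open>n\<close>-step self-avoiding walks. A lower bound on it is informative
  only for graphs on which this limit exists for every starting vertex and does not depend
  on it, as is the case for the quasi-transitive connected graphs considered here.\<close>

definition connective_constant :: "'a set \<Rightarrow> 'a set set \<Rightarrow> real" where
  "connective_constant V E =
     (THE \<mu>. \<forall>v\<in>V. (\<lambda>n. root n (real (saw_count E v n))) \<longlonglongrightarrow> \<mu>)"


section \<open>Functions on the vertices\<close>

definition harmonic :: "'a set \<Rightarrow> 'a set set \<Rightarrow> ('a \<Rightarrow> real) \<Rightarrow> bool" where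
  "harmonic V E h \<longleftrightarrow>
     (\<forall>v\<in>V. h v = 1 / real (card (neighbours E v)) * (\<Sum>u\<in>neighbours E v. h u))"

definition maximal_neighbour ::
    "'a set \<Rightarrow> 'a set set \<Rightarrow> ('a \<Rightarrow> real) \<Rightarrow> ('a \<Rightarrow> 'a) \<Rightarrow> bool" where
  "maximal_neighbour V E h m \<longleftrightarrow>
     (\<forall>u\<in>V. m u \<in> neighbours E u \<and> (\<forall>x\<in>neighbours E u. h x - h u \<le> h (m u) - h u))"

definition max_incr :: "('a \<Rightarrow> real) \<Rightarrow> ('a \<Rightarrow> 'a) \<Rightarrow> 'a \<Rightarrow> real" where
  "max_incr h m u = h (m u) - h u"

text \<open>The vertex \<open>Q(u)\<close>; it is well defined in a cubic graph if \<open>m (m u) \<noteq> u\<close>.\<close>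

definition qm :: "'a set set \<Rightarrow> ('a \<Rightarrow> 'a) \<Rightarrow> 'a \<Rightarrow> 'a" where
  "qm E m u = (THE w. w \<in> neighbours E (m u) \<and> w \<noteq> u \<and> w \<noteq> m (m u))"

text \<open>\<open>m\<close> is a choice of maximizing neighbours for \<open>h\<close> for which \<open>Q\<close> is well defined.\<close>

definition admissible_choice ::
    "'a set \<Rightarrow> 'a set set \<Rightarrow> ('a \<Rightarrow> real) \<Rightarrow> ('a \<Rightarrow> 'a) \<Rightarrow> bool" where
  "admissible_choice V E h m \<longleftrightarrow> maximal_neighbour V E h m \<and> (\<forall>u\<in>V. m (m u) \<noteq> u)"

definition graph_height_function ::
    "'a set \<Rightarrow> 'a set set \<Rightarrow> 'a \<Rightarrow> ('a \<Rightarrow> int) \<Rightarrow> ('a \<Rightarrow> 'a) set \<Rightarrow> bool" where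
  "graph_height_function V E r h H \<longleftrightarrow>
     h r = 0 \<and>
     subgroup H (aut_group V E) \<and>
     finitely_many_orbits V E H \<and>
     (\<forall>\<alpha>\<in>H. \<forall>u\<in>V. \<forall>v\<in>V. h (\<alpha> v) - h (\<alpha> u) = h v - h u) \<and>
     (\<forall>v\<in>V. \<exists>u\<in>neighbours E v. \<exists>w\<in>neighbours E v. h u < h v \<and> h v < h w)"

definition transitive_graph_height_function ::
    "'a set \<Rightarrow> 'a set set \<Rightarrow> 'a \<Rightarrow> ('a \<Rightarrow> int) \<Rightarrow> ('a \<Rightarrow> 'a) set \<Rightarrow> bool" where
  "transitive_graph_height_function V E r h H \<longleftrightarrow>
     graph_height_function V E r h H \<and> acts_transitively V H"


section \<open>Well-definedness\<close>

lemma subgroup_aut: "subgroup (carrier (aut_group V E)) (BijGroup V)"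
proof -
  interpret group "BijGroup V" by (rule group_BijGroup)
  let ?A = "carrier (aut_group V E)"
  have mem: "\<alpha> \<in> ?A \<longleftrightarrow>
      \<alpha> \<in> Bij V \<and> (\<forall>u\<in>V. \<forall>v\<in>V. adjacent E (\<alpha> u) (\<alpha> v) \<longleftrightarrow> adjacent E u v)" for \<alpha>
    by (simp add: aut_group_def)
  show ?thesis
  proof (rule subgroupI)
    show "?A \<subseteq> carrier (BijGroup V)"
      by (auto simp: mem BijGroup_def)
    have "(\<lambda>x\<in>V. x) \<in> ?A"
      by (auto simp: mem id_Bij)
    then show "?A \<noteq> {}" by blast
  next
    fix \<alpha> assume a: "\<alpha> \<in> ?A"
    then have B: "\<alpha> \<in> Bij V" by (simp add: mem)
    then have bij: "bij_betw \<alpha> V V" by (simp add: Bij_def)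
    have 1: "inv_into V \<alpha> u \<in> V" "\<alpha> (inv_into V \<alpha> u) = u" if "u \<in> V" for u
      using that B bij by (auto simp: Bij_inv_into_mem bij_betw_inv_into_right)
    have "(\<lambda>x\<in>V. inv_into V \<alpha> x) \<in> ?A"
      using a 1 by (auto simp: mem restrict_inv_into_Bij) metis+
    then show "inv\<^bsub>BijGroup V\<^esub> \<alpha> \<in> ?A"
      using B by (simp add: inv_BijGroup)
  next
    fix \<alpha> \<beta> assume a: "\<alpha> \<in> ?A" "\<beta> \<in> ?A"
    then have B: "\<alpha> \<in> Bij V" "\<beta> \<in> Bij V" by (auto simp: mem)
    have "\<beta> u \<in> V" if "u \<in> V" for u
      using that Bij_imp_funcset[OF B(2)] by blast
    then have "compose V \<alpha> \<beta> \<in> ?A"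
      using a B by (simp add: mem compose_Bij compose_eq)
    then show "\<alpha> \<otimes>\<^bsub>BijGroup V\<^esub> \<beta> \<in> ?A"
      using B by (simp add: BijGroup_def)
  qed
qed

lemma group_aut_group: "group (aut_group V E)"
proof -
  have "aut_group V E = BijGroup V\<lparr>carrier := carrier (aut_group V E)\<rparr>"
    by (simp add: aut_group_def)
  then show ?thesis
    using group.subgroup_imp_group[OF group_BijGroup subgroup_aut] by metis
qed

lemma qm_well_defined:
  assumes "simple_graph V E" "cubic V E" "admissible_choice V E h m" "u \<in> V"
  shows "\<exists>!w. w \<in> neighbours E (m u) \<and> w \<noteq> u \<and> w \<noteq> m (m u)"
proof -
  have V: "x \<in> V" if "x \<in> neighbours E y" for x y
    using assms(1) that by (fastforce simp: simple_graph_def neighbours_def adjacent_def doubleton_eq_iff)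
  have mu: "m u \<in> neighbours E u" and ne: "m (m u) \<noteq> u"
    using assms by (auto simp: admissible_choice_def maximal_neighbour_def)
  then have mV: "m u \<in> V" using V by blast
  let ?N = "neighbours E (m u)"
  have N: "u \<in> ?N" "m (m u) \<in> ?N" "card ?N = 3"
    using mu mV assms(2,3)
    by (auto simp: neighbours_def adjacent_def insert_commute cubic_def admissible_choice_def
        maximal_neighbour_def)
  then have "card (?N - {u, m (m u)}) = 1"
    using ne by (subst card_Diff_subset) auto
  then obtain w where "?N - {u, m (m u)} = {w}"
    by (auto simp: card_1_singleton_iff)
  then show ?thesis by (intro ex1I[of _ w]) blast+
qed

end

theory Submission
  imports Defs "HOL-Real_Asymp.Real_Asymp"
begin

text \<open>
  Each of the four hypotheses yields a function \<open>h\<close> and an admissible choice \<open>m\<close> with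
  \<open>h u < h (Q u)\<close> and \<open>h (m u) < h (m (Q u))\<close> for all \<open>u\<close>; in case (b), up to the sign of
  the height function. For such a choice, consider the walks composed of blocks \<open>u, m u\<close> and
  \<open>u, m u, Q u\<close>. Along them \<open>h\<close> increases in every two consecutive steps. If such a walk closed
  up at the start of a block it could be repeated periodically, contradicting this increase;
  a shortest closed subwalk starting inside a block \<open>u, m u, Q u\<close> reduces to that case, or
  else \<open>Q (Q y) = y\<close> for some \<open>y\<close>. So these walks are self-avoiding. As the
  blocks have lengths 1 and 2, there are Fibonacci many walks of length \<open>n\<close>.

  That the connective constant exists is Hammersley's theorem: the maxima over all starting
  vertices of the numbers of \<open>n\<close>-step self-avoiding walks are submultiplicative in \<open>n\<close>, and
  walks from one vertex can be rerouted to start from any other one.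
\<close>

section \<open>Graphs and self-avoiding walks\<close>

lemma adjacent_sym: "adjacent E u v \<longleftrightarrow> adjacent E v u"
  by (simp add: adjacent_def insert_commute)

lemma adjacent_sym_rel: "(\<lambda>u v. adjacent E v u) = adjacent E"
  by (auto simp: adjacent_sym intro!: ext)

lemma adjacent_mem:
  assumes "simple_graph V E" "adjacent E u v"
  shows "u \<in> V" "v \<in> V" "u \<noteq> v"
  using assms by (fastforce simp: simple_graph_def adjacent_def doubleton_eq_iff)+

lemma neighbours_mem: "simple_graph V E \<Longrightarrow> u \<in> neighbours E v \<Longrightarrow> u \<in> V"
  by (auto simp: neighbours_def adjacent_mem)

lemma cubic_neighbours_finite: "cubic V E \<Longrightarrow> v \<in> V \<Longrightarrow> finite (neighbours E v)"
  unfolding cubic_def by (intro card_ge_0_finite) simp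

lemma successively_mem:
  assumes "simple_graph V E" "successively (adjacent E) p" "p \<noteq> []" "hd p \<in> V"
  shows "set p \<subseteq> V"
  using assms(2-)
proof (induction p)
  case (Cons x p)
  then show ?case
    by (cases "p = []") (auto simp: successively_Cons dest: adjacent_mem[OF assms(1)])
qed simp

lemma finite_saws:
  assumes G: "simple_graph V E" "\<And>v. v \<in> V \<Longrightarrow> finite (neighbours E v)" and "v \<in> V"
  shows "finite (saws E v n)"
  using \<open>v \<in> V\<close>
proof (induction n arbitrary: v)
  case 0
  have "saws E v 0 \<subseteq> {[v]}" by (auto simp: saws_def length_Suc_conv)
  then show ?case by (rule finite_subset) simp
next
  case (Suc n)
  have "saws E v (Suc n) \<subseteq> Cons v ` (\<Union>u\<in>neighbours E v. saws E u n)"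
  proof
    fix p assume "p \<in> saws E v (Suc n)"
    then obtain q where q: "p = v # q" "length q = n + 1" "successively (adjacent E) p" "distinct p"
      by (cases p) (auto simp: saws_def)
    then have "hd q \<in> neighbours E v" "q \<in> saws E (hd q) n"
      by (auto simp: saws_def neighbours_def successively_Cons)
    with q(1) show "p \<in> Cons v ` (\<Union>u\<in>neighbours E v. saws E u n)" by blast
  qed
  moreover have "finite (\<Union>u\<in>neighbours E v. saws E u n)"
    using Suc.IH neighbours_mem[OF G(1)] G(2)[OF Suc.prems] by (intro finite_UN_I) auto
  ultimately show ?case by (meson finite_imageI finite_subset)
qed

section \<open>Cutting and rerouting walks\<close>

text \<open>A walk is cut at its vertex of index \<open>k\<close>, which both pieces keep; so the
  pieces have \<open>k\<close> and \<open>n\<close> steps, and together they determine the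
  walk.\<close>

lemma saw_count_add:
  assumes G: "simple_graph V E" "\<And>v. v \<in> V \<Longrightarrow> finite (neighbours E v)" and "v \<in> V"
    and bound: "\<And>u. u \<in> V \<Longrightarrow> saw_count E u n \<le> A"
  shows "saw_count E v (k + n) \<le> saw_count E v k * A"
proof -
  let ?T = "SIGMA p:saws E v k. saws E (last p) n"
  let ?f = "\<lambda>p. (take (Suc k) p, drop k p)"
  have lastV: "last p \<in> V" if "p \<in> saws E v k" for p
  proof -
    have "p \<noteq> []" "set p \<subseteq> V"
      using that successively_mem[OF G(1), of p] \<open>v \<in> V\<close> by (cases "p = []"; auto simp: saws_def)+
    then show ?thesis by auto
  qed
  have inj: "inj_on ?f (saws E v (k + n))"
  proof (rule inj_onI)
    fix p q assume eq: "?f p = ?f q"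
    then have "take k (take (Suc k) p) = take k (take (Suc k) q)" by simp
    then have "take k p = take k q" by simp
    then show "p = q" using eq by (metis Pair_inject append_take_drop_id)
  qed
  have "?f ` saws E v (k + n) \<subseteq> ?T"
  proof (rule image_subsetI)
    fix p assume "p \<in> saws E v (k + n)"
    then have p: "length p = Suc (k + n)" "hd p = v" "successively (adjacent E) p" "distinct p"
      by (auto simp: saws_def)
    have last: "last (take (Suc k) p) = p ! k" using p(1)
      by (simp add: take_Suc_conv_app_nth)
    have "successively (adjacent E) (take (Suc k) p @ drop (Suc k) p)"
      "successively (adjacent E) (take k p @ drop k p)" using p(3) by simp_all
    then have "successively (adjacent E) (take (Suc k) p)" "successively (adjacent E) (drop k p)"
      unfolding successively_append_iff by blast+
    then show "?f p \<in> ?T"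
      using p last by (auto simp: saws_def hd_drop_conv_nth)
  qed
  then have "card (saws E v (k + n)) \<le> card ?T"
    using inj finite_saws[OF G] \<open>v \<in> V\<close> lastV
    by (intro card_inj_on_le[OF inj]) auto
  also have "\<dots> = (\<Sum>p\<in>saws E v k. saw_count E (last p) n)"
    using finite_saws[OF G] \<open>v \<in> V\<close> lastV by (subst card_SigmaI) (auto simp: saw_count_def)
  also have "\<dots> \<le> saw_count E v k * A"
    using sum_bounded_above[of "saws E v k" "\<lambda>p. saw_count E (last p) n" A] bound lastV
    by (simp add: saw_count_def)
  finally show ?thesis by (simp add: saw_count_def)
qed

lemma connected_distinct_path:
  assumes "(adjacent E)\<^sup>*\<^sup>* v w"
  shows "\<exists>p. p \<noteq> [] \<and> hd p = v \<and> last p = w \<and> successively (adjacent E) p \<and> distinct p"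
  using assms
proof (induction rule: rtranclp_induct)
  case base
  show ?case by (intro exI[of _ "[v]"]) simp
next
  case (step x y)
  then obtain p where p: "p \<noteq> []" "hd p = v" "last p = x" "successively (adjacent E) p" "distinct p"
    by blast
  show ?case
  proof (cases "y \<in> set p")
    case False
    then show ?thesis
      using p step(2) by (intro exI[of _ "p @ [y]"]) (auto simp: successively_append_iff)
  next
    \<comment> \<open>Loop erasure: the path is cut off at its earlier visit to
      \<open>y\<close>.\<close>
    case True
    then obtain a b where "p = a @ y # b" by (meson split_list)
    then have "p = (a @ [y]) @ b" by simp
    with p show ?thesis
      by (intro exI[of _ "a @ [y]"]) (auto simp: successively_append_iff hd_append)
  qed
qed

text \<open>Follow a path from \<open>v\<close> to \<open>w\<close> until it first meets a given walk from \<open>w\<close>; from there the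
  walk can be followed in both directions.\<close>

lemma saw_count_change_start:
  assumes G: "simple_graph V E" "\<And>v. v \<in> V \<Longrightarrow> finite (neighbours E v)" and V: "v \<in> V"
    and path: "y \<noteq> []" "hd y = v" "last y = w" "successively (adjacent E) y" "distinct y"
  shows "saw_count E w n \<le>
    (\<Sum>i<length y. \<Sum>k\<le>n. saw_count E v (i + (n - k)) * saw_count E v (i + k))"
proof -
  let ?T = "SIGMA i:{..<length y}. SIGMA k:{..n}. saws E v (i + (n - k)) \<times> saws E v (i + k)"
  \<comment> \<open>The path takes \<open>i\<close> steps to the meeting point, which has index
    \<open>k\<close> in the walk; from there \<open>p\<close> follows the walk forwards and
    \<open>q\<close> backwards. Both halves contain the meeting point, so one of them gives it up
    when they are glued together.\<close>
  let ?g = "\<lambda>(i, k, p, q). rev (drop (Suc i) q) @ drop i p"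
  have "saws E w n \<subseteq> ?g ` ?T"
  proof
    fix s assume "s \<in> saws E w n"
    then have s: "length s = Suc n" "hd s = w" "successively (adjacent E) s" "distinct s"
      by (auto simp: saws_def)
    then have "w \<in> set s" by (metis hd_in_set list.size(3) nat.distinct(1))
    then have "\<exists>x\<in>set y. x \<in> set s" using path last_in_set by blast
    then obtain a b c where y: "y = a @ b # c" and b: "b \<in> set s" and a: "\<forall>x\<in>set a. x \<notin> set s"
      using split_list_first_prop[of y "\<lambda>x. x \<in> set s"] by blast
    obtain d e where s': "s = d @ b # e" using b by (meson split_list)
    have len: "length d \<le> n" "length e = n - length d" using s s' by auto
    have sy: "successively (adjacent E) a" "a = [] \<or> adjacent E (last a) b" "distinct (a @ [b])"
      "hd (a @ [b]) = v"
      using path y by (auto simp: successively_append_iff successively_Cons hd_append)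
    have ss: "successively (adjacent E) d" "d = [] \<or> adjacent E (last d) b"
      "successively (adjacent E) (b # e)"
      using s s' by (auto simp: successively_append_iff)
    have p: "a @ b # e \<in> saws E v (length a + (n - length d))"
      using a s s' sy ss len path y by (auto simp: saws_def successively_append_iff hd_append)
    have "successively (adjacent E) (b # rev d)"
      using ss by (auto simp: successively_Cons adjacent_sym_rel hd_rev adjacent_sym)
    then have q: "a @ b # rev d \<in> saws E v (length a + length d)"
      using a s s' sy path y by (auto simp: saws_def successively_append_iff hd_append)
    have "(length a, length d, a @ b # e, a @ b # rev d) \<in> ?T"
      using p q len y by auto
    moreover have "?g (length a, length d, a @ b # e, a @ b # rev d) = s"
      using s' by simp
    ultimately show "s \<in> ?g ` ?T" by (metis (no_types, lifting) image_eqI)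
  qed
  moreover have fin: "finite ?T" by (auto intro!: finite_SigmaI finite_cartesian_product finite_saws[OF G] V)
  ultimately have "saw_count E w n \<le> card ?T"
    unfolding saw_count_def by (meson surj_card_le)
  also have "card ?T = (\<Sum>i<length y. card (SIGMA k:{..n}. saws E v (i + (n - k)) \<times> saws E v (i + k)))"
    by (subst card_SigmaI) (auto intro!: finite_SigmaI finite_cartesian_product finite_saws[OF G] V)
  also have "\<dots> = (\<Sum>i<length y. \<Sum>k\<le>n. saw_count E v (i + (n - k)) * saw_count E v (i + k))"
    by (intro sum.cong refl, subst card_SigmaI)
      (auto intro!: finite_SigmaI finite_cartesian_product finite_saws[OF G] V
        simp: card_cartesian_product saw_count_def)
  finally show ?thesis .
qed

section \<open>Automorphisms and orbits\<close>

lemma saw_count_automorphism_le: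
  assumes G: "simple_graph V E" "\<And>v. v \<in> V \<Longrightarrow> finite (neighbours E v)"
    and \<alpha>: "\<alpha> \<in> carrier (aut_group V E)" and V: "v \<in> V"
  shows "saw_count E v n \<le> saw_count E (\<alpha> v) n"
proof -
  have bij: "bij_betw \<alpha> V V" and adj: "\<And>u w. u \<in> V \<Longrightarrow> w \<in> V \<Longrightarrow> adjacent E (\<alpha> u) (\<alpha> w) \<longleftrightarrow> adjacent E u w"
    using \<alpha> by (auto simp: aut_group_def Bij_def)
  have pV: "set p \<subseteq> V" if "p \<in> saws E v n" for p
    using that V successively_mem[OF G(1), of p] by (cases "p = []") (auto simp: saws_def)
  have inj: "inj_on (map \<alpha>) (saws E v n)"
  proof (rule inj_onI)
    fix p q assume "p \<in> saws E v n" "q \<in> saws E v n" "map \<alpha> p = map \<alpha> q"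
    then show "p = q"
      using map_inj_on[of \<alpha> p q] inj_on_subset[OF bij_betw_imp_inj_on[OF bij], of "set p \<union> set q"] pV
      by blast
  qed
  have "map \<alpha> ` saws E v n \<subseteq> saws E (\<alpha> v) n"
  proof (rule image_subsetI)
    fix p assume p: "p \<in> saws E v n"
    have "successively (\<lambda>u w. adjacent E (\<alpha> u) (\<alpha> w)) p"
      using p pV[OF p] by (auto simp: saws_def adj subset_iff elim!: successively_mono)
    moreover have "p \<noteq> []" using p by (auto simp: saws_def)
    ultimately show "map \<alpha> p \<in> saws E (\<alpha> v) n"
      using p pV[OF p] bij
      by (auto simp: saws_def successively_map distinct_map hd_map bij_betw_def intro: inj_on_subset)
  qed
  moreover have "finite (saws E (\<alpha> v) n)"
    using finite_saws[OF G] bij V by (meson bij_betwE)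
  ultimately show ?thesis
    unfolding saw_count_def by (intro card_inj_on_le[OF inj])
qed

text \<open>Quasi-transitivity enters here: the counts are constant on orbits, so a bound over all
  starting vertices becomes a maximum over a finite set.\<close>

lemma orbit_representatives:
  assumes G: "simple_graph V E" "\<And>v. v \<in> V \<Longrightarrow> finite (neighbours E v)"
    and orbits: "finitely_many_orbits V E (carrier (aut_group V E))"
  obtains W where "finite W" "W \<subseteq> V" "\<And>v. v \<in> V \<Longrightarrow> \<exists>w\<in>W. saw_count E v = saw_count E w"
proof -
  define orb where "orb x = {\<alpha> x | \<alpha>. \<alpha> \<in> carrier (aut_group V E)}" for x
  have "finite (orb ` V)"
    using orbits by (simp add: finitely_many_orbits_def orbits_def orbit_def orb_def image_def
        Setcompr_eq_image)
  then obtain W where W: "finite W" "W \<subseteq> V" "orb ` V = orb ` W"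
    by (meson finite_subset_image order_refl)
  have id: "x \<in> orb x" if "x \<in> V" for x
  proof -
    have "(\<lambda>x\<in>V. x) \<in> carrier (aut_group V E)" by (auto simp: aut_group_def id_Bij)
    moreover have "x = (\<lambda>x\<in>V. x) x" using that by simp
    ultimately show ?thesis unfolding orb_def by blast
  qed
  have le: "saw_count E x n \<le> saw_count E y n" if "y \<in> orb x" "x \<in> V" for x y n
    using that saw_count_automorphism_le[OF G] by (auto simp: orb_def)
  have "\<exists>w\<in>W. saw_count E v = saw_count E w" if v: "v \<in> V" for v
  proof -
    obtain w where w: "w \<in> W" "orb v = orb w" using v W by blast
    \<comment> \<open>Each vertex lies in its own orbit by the identity, so equal orbits give
      membership both ways, and with it both inequalities.\<close>
    then have "v \<in> orb w" "w \<in> orb v" using id v W by blast+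
    then have "saw_count E v n \<le> saw_count E w n" "saw_count E w n \<le> saw_count E v n" for n
      using le v w(1) W(2) by blast+
    then show ?thesis using w by (intro bexI[of _ w] ext antisym) auto
  qed
  with W that show thesis by blast
qed

section \<open>Existence of the connective constant\<close>

text \<open>Fekete's lemma, with \<open>L\<close> the infimum of \<open>a n / real n\<close>. The
  upper bound is stated for every \<open>n\<close>, at the price of a constant, because it will be
  applied to remainders of any size.\<close>

lemma subadditive_growth:
  fixes a :: "nat \<Rightarrow> real"
  assumes sub: "\<And>m n. a (m + n) \<le> a m + a n" and nonneg: "\<And>n. 0 \<le> a n"
  obtains L where "0 \<le> L" "\<And>n. real n * L \<le> a n"
    "\<And>e. e > 0 \<Longrightarrow> \<exists>C. \<forall>n. a n \<le> real n * (L + e) + C"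
proof
  define S where "S = (\<lambda>n. a n / real n) ` {1..}"
  have S: "S \<noteq> {}" "bdd_below S" "\<And>x. x \<in> S \<Longrightarrow> 0 \<le> x"
    using nonneg by (auto simp: S_def intro!: bdd_belowI[of _ 0])
  show "0 \<le> Inf S" using S by (intro cInf_greatest)
  show "real n * Inf S \<le> a n" for n
  proof (cases "n = 0")
    case False
    then have "Inf S \<le> a n / real n" using S by (intro cInf_lower) (auto simp: S_def)
    with False show ?thesis by (simp add: field_simps)
  qed (use nonneg in simp)
  fix e :: real assume "e > 0"
  then obtain x where "x \<in> S" "x < Inf S + e"
    using cInf_lessD[OF S(1), of "Inf S + e"] by auto
  then obtain k where k: "k \<ge> 1" "a k / real k < Inf S + e" by (auto simp: S_def)
  define t where "t = Inf S + e"
  have t: "a k \<le> real k * t" "t \<ge> 0"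
    using k \<open>e > 0\<close> \<open>0 \<le> Inf S\<close> by (auto simp: field_simps t_def)
  have mult: "a (q * k + j) \<le> real q * a k + a j" for q j
  proof (induction q)
    case (Suc q)
    have "a (Suc q * k + j) = a (k + (q * k + j))" by (simp add: algebra_simps)
    with Suc sub[of k "q * k + j"] show ?case by (simp add: algebra_simps)
  qed simp
  have "a n \<le> real n * t + (\<Sum>j<k. a j)" for n
  proof -
    have "a n = a (n div k * k + n mod k)" by simp
    also have "\<dots> \<le> real (n div k) * a k + a (n mod k)" by (rule mult)
    also have "real (n div k) * a k \<le> real (n div k) * (real k * t)"
      using t by (intro mult_left_mono) auto
    also have "\<dots> = real (n div k * k) * t" by simp
    also have "\<dots> \<le> real n * t"
      using t div_times_less_eq_dividend[of n k] by (intro mult_right_mono of_nat_mono) auto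
    \<comment> \<open>The remainders below \<open>k\<close> are absorbed into the additive
      constant.\<close>
    also have "a (n mod k) \<le> (\<Sum>j<k. a j)"
      using k nonneg by (intro member_le_sum) auto
    finally show ?thesis by simp
  qed
  then show "\<exists>C. \<forall>n. a n \<le> real n * (Inf S + e) + C" by (auto simp: t_def)
qed

text \<open>Any product \<open>s (i + k) * s (i + (2 * n - k))\<close> has a factor of index at least \<open>n\<close>, and
  that factor is at most \<open>s n\<close> times the maximal growth of the remainder.\<close>

lemma Hammersley_limit:
  fixes s A :: "nat \<Rightarrow> real"
  assumes A: "\<And>m n. A (m + n) \<le> A m * A n" "\<And>n. 1 \<le> A n"
    and s: "\<And>n. 1 \<le> s n" "\<And>n. s n \<le> A n" "\<And>m n. s (m + n) \<le> s m * A n"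
    and doubling: "\<And>n. A (2 * n) \<le> (\<Sum>i<l. \<Sum>k\<le>2 * n. s (i + (2 * n - k)) * s (i + k))"
    and L: "\<And>n. real n * L \<le> ln (A n)"
      "\<And>e. e > 0 \<Longrightarrow> \<exists>C. \<forall>n. ln (A n) \<le> real n * (L + e) + C" "0 \<le> L"
  shows "(\<lambda>n. root n (s n)) \<longlonglongrightarrow> exp L"
proof -
  have pos: "A n > 0" "s n > 0" for n using A(2)[of n] s(1)[of n] by linarith+
  have "l > 0"
  proof (rule ccontr)
    assume "\<not> l > 0"
    then show False using doubling[of 0] pos(1)[of 0] by simp
  qed
  have "(\<lambda>n. ln (s n) / real n) \<longlonglongrightarrow> L"
  proof (rule order_tendstoI)
    fix x assume "L < x"
    define e where "e = (x - L) / 2"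
    have "e > 0" using \<open>L < x\<close> by (simp add: e_def)
    then obtain C where C: "\<And>n. ln (A n) \<le> real n * (L + e) + C" using L(2) by blast
    have up: "ln (s n) / real n \<le> (L + e) + C / real n" if "n > 0" for n
    proof -
      have "ln (s n) \<le> ln (A n)" using s(2) pos by simp
      also have "\<dots> \<le> real n * (L + e) + C" by (rule C)
      finally show ?thesis using that by (simp add: field_simps)
    qed
    have "(\<lambda>n. (L + e) + C / real n) \<longlonglongrightarrow> L + e" by real_asymp
    moreover have "L + e < x" using \<open>L < x\<close> by (simp add: e_def field_simps)
    ultimately have "\<forall>\<^sub>F n in sequentially. (L + e) + C / real n < x" by (rule order_tendstoD)
    with eventually_gt_at_top[of 0] show "\<forall>\<^sub>F n in sequentially. ln (s n) / real n < x"
      by eventually_elim (use up in \<open>auto intro: le_less_trans\<close>)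
  next
    fix x assume "x < L"
    define e where "e = (L - x) / 2"
    have "e > 0" using \<open>x < L\<close> by (simp add: e_def)
    then obtain C where C: "\<And>n. ln (A n) \<le> real n * (L + e) + C" using L(2) by blast
    have Aexp: "A n \<le> exp (real n * (L + e) + C)" for n
      using C[of n] pos(1)[of n] by (metis exp_le_cancel_iff exp_ln)
    \<comment> \<open>\<open>2 * C\<close> comes from two uses of \<open>Aexp\<close>, and the other
      term from the at most \<open>2 * l\<close> extra steps along the connecting path.\<close>
    define D where "D = 2 * C + 2 * real l * (L + e)"
    have prod: "s j * s k \<le> s n * exp (real n * (L + e) + D)"
      if "j + k = 2 * i + 2 * n" "i < l" "n \<le> j" for i j k n
    proof -
      \<comment> \<open>Only the first \<open>n\<close> steps of the longer factor are kept; the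
        remaining \<open>j - n\<close> and \<open>k\<close> steps, in total
        \<open>n + 2 * i\<close>, are estimated by \<open>A\<close>.\<close>
      have "s j \<le> s n * A (j - n)" using s(3)[of n "j - n"] that by simp
      also have "\<dots> \<le> s n * exp (real (j - n) * (L + e) + C)"
        using Aexp pos by (intro mult_left_mono) (auto intro: less_imp_le)
      finally have "s j * s k \<le> (s n * exp (real (j - n) * (L + e) + C)) * exp (real k * (L + e) + C)"
        using pos Aexp order.trans[OF s(2) Aexp] by (intro mult_mono) (auto intro: less_imp_le)
      also have "\<dots> = s n * exp ((real (j - n) + real k) * (L + e) + 2 * C)"
        unfolding mult.assoc exp_add[symmetric] by (simp add: distrib_right)
      also have "real (j - n) + real k = real n + 2 * real i"
        using that by linarith
      also have "(real n + 2 * real i) * (L + e) + 2 * C \<le> real n * (L + e) + D"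
      proof -
        have "real i * (L + e) \<le> real l * (L + e)"
          using that \<open>e > 0\<close> L(3) by (intro mult_right_mono) auto
        then show ?thesis by (simp add: D_def algebra_simps)
      qed
      then have "s n * exp ((real n + 2 * real i) * (L + e) + 2 * C) \<le> s n * exp (real n * (L + e) + D)"
        using pos by (intro mult_left_mono) (auto intro: less_imp_le)
      finally show ?thesis .
    qed
    have low: "L - e - (ln (real l * (2 * real n + 1)) + D) / real n \<le> ln (s n) / real n"
      if "n > 0" for n
    proof -
      let ?B = "s n * exp (real n * (L + e) + D)"
      have "A (2 * n) \<le> (\<Sum>i<l. \<Sum>k\<le>2 * n. s (i + (2 * n - k)) * s (i + k))" by (rule doubling)
      also have "\<dots> \<le> (\<Sum>i<l. \<Sum>k\<le>2 * n. ?B)"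
      proof (intro sum_mono)
        fix i k assume ik: "i \<in> {..<l}" "k \<in> {..2 * n}"
        show "s (i + (2 * n - k)) * s (i + k) \<le> ?B"
        proof (cases "n \<le> i + k")
          case True
          then show ?thesis using prod[of "i + k" "i + (2 * n - k)" i n] ik by (simp add: mult.commute)
        next
          case False
          then show ?thesis using prod[of "i + (2 * n - k)" "i + k" i n] ik by simp
        qed
      qed
      also have "\<dots> = (real l * (2 * real n + 1)) * ?B" by (simp add: algebra_simps)
      finally have *: "A (2 * n) \<le> (real l * (2 * real n + 1)) * ?B" .
      \<comment> \<open>The exponent \<open>2 * n * L\<close> on the left meets
        \<open>n * (L + e)\<close> on the right, which leaves \<open>n * (L - e)\<close> for
        \<open>ln (s n)\<close>; the number of summands contributes only a logarithm.\<close>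
      have "real (2 * n) * L \<le> ln (A (2 * n))" by (rule L)
      also have "\<dots> \<le> ln ((real l * (2 * real n + 1)) * ?B)" using * pos(1) by (intro ln_mono)
      also have "\<dots> = ln (real l * (2 * real n + 1)) + (ln (s n) + (real n * (L + e) + D))"
        using pos[of n] \<open>l > 0\<close> by (subst ln_mult; simp add: ln_mult)
      finally have "(L - e) * real n - (ln (real l * (2 * real n + 1)) + D) \<le> ln (s n)"
        by (simp add: algebra_simps)
      then have "((L - e) * real n - (ln (real l * (2 * real n + 1)) + D)) / real n \<le> ln (s n) / real n"
        by (rule divide_right_mono) simp
      then show ?thesis using that by (simp add: diff_divide_distrib)
    qed
    have "(\<lambda>n. L - e - (ln (real l * (2 * real n + 1)) + D) / real n) \<longlonglongrightarrow> L - e"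
      using \<open>l > 0\<close> by real_asymp
    moreover have "x < L - e" using \<open>x < L\<close> by (simp add: e_def field_simps)
    ultimately have "\<forall>\<^sub>F n in sequentially. x < L - e - (ln (real l * (2 * real n + 1)) + D) / real n"
      by (rule order_tendstoD)
    with eventually_gt_at_top[of 0] show "\<forall>\<^sub>F n in sequentially. x < ln (s n) / real n"
      by eventually_elim (use low in \<open>auto intro: less_le_trans\<close>)
  qed
  then have "(\<lambda>n. exp (ln (s n) / real n)) \<longlonglongrightarrow> exp L" by (rule tendsto_exp)
  moreover have "\<forall>\<^sub>F n in sequentially. exp (ln (s n) / real n) = root n (s n)"
    using eventually_gt_at_top[of 0]
  proof eventually_elim
    case (elim n)
    then show ?case using pos(2)[of n] by (simp add: root_powr_inverse powr_def)
  qed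
  ultimately show ?thesis by (rule Lim_transform_eventually)
qed

text \<open>The positivity hypothesis makes logarithms of the counts nonnegative. In the application
  it comes from the lower bound by golden walks.\<close>

theorem connective_constant_exists:
  assumes G: "Q3 V E r" and pos: "\<And>v n. v \<in> V \<Longrightarrow> saw_count E v n \<noteq> 0"
  shows "\<exists>\<mu>. \<forall>v\<in>V. (\<lambda>n. root n (real (saw_count E v n))) \<longlonglongrightarrow> \<mu>"
proof -
  have sg: "simple_graph V E" and conn: "connected_graph V E" and r: "r \<in> V"
    and fin: "\<And>v. v \<in> V \<Longrightarrow> finite (neighbours E v)"
    using G cubic_neighbours_finite by (auto simp: Q3_def)
  obtain W where W: "finite W" "W \<subseteq> V" and rep: "\<And>v. v \<in> V \<Longrightarrow> \<exists>w\<in>W. saw_count E v = saw_count E w"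
    using orbit_representatives[OF sg fin] G by (auto simp: Q3_def)
  define A where "A n = Max ((\<lambda>w. saw_count E w n) ` W)" for n
  have Wne: "W \<noteq> {}" using rep[OF r] by blast
  have le_A: "saw_count E v n \<le> A n" if v: "v \<in> V" for v n
  proof -
    obtain w where "w \<in> W" "saw_count E v = saw_count E w" using rep v by blast
    then show ?thesis using W by (simp add: A_def)
  qed
  have attained: "\<exists>w\<in>W. A n = saw_count E w n" for n
    using Max_in[of "(\<lambda>w. saw_count E w n) ` W"] W Wne unfolding A_def by blast
  have sub: "saw_count E v (m + n) \<le> saw_count E v m * A n" if "v \<in> V" for v m n
    using saw_count_add[OF sg fin that le_A] by blast
  have A1: "1 \<le> A n" for n using le_A[OF r, of n] pos[OF r, of n] by simp
  have Asub: "A (m + n) \<le> A m * A n" for m n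
  proof -
    obtain w where w: "w \<in> W" "A (m + n) = saw_count E w (m + n)" using attained by blast
    then have "A (m + n) \<le> saw_count E w m * A n" using sub W by auto
    also have "\<dots> \<le> A m * A n" using le_A w W by auto
    finally show ?thesis .
  qed
  have lnsub: "ln (real (A (m + n))) \<le> ln (real (A m)) + ln (real (A n))" for m n
  proof -
    have p: "0 < real (A i)" for i using A1[of i] by simp
    have "ln (real (A (m + n))) \<le> ln (real (A m * A n))"
      using Asub[of m n] p[of "m + n"] by (intro ln_mono) linarith+
    also have "\<dots> = ln (real (A m)) + ln (real (A n))" using p[of m] p[of n] by (simp add: ln_mult)
    finally show ?thesis .
  qed
  have ln0: "0 \<le> ln (real (A n))" for n using A1[of n] by simp
  \<comment> \<open>\<open>L\<close> is obtained from \<open>A\<close> before a starting vertex is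
    chosen, so all vertices share the same limit.\<close>
  obtain L where L: "0 \<le> L" "\<And>n. real n * L \<le> ln (real (A n))"
    "\<And>e. e > 0 \<Longrightarrow> \<exists>C. \<forall>n. ln (real (A n)) \<le> real n * (L + e) + C"
    using subadditive_growth[of "\<lambda>n. ln (real (A n))", OF lnsub ln0] by blast
  have "(\<lambda>n. root n (real (saw_count E v n))) \<longlonglongrightarrow> exp L" if v: "v \<in> V" for v
  proof -
    have "\<exists>p. p \<noteq> [] \<and> hd p = v \<and> last p = w \<and> successively (adjacent E) p \<and> distinct p"
      if "w \<in> W" for w
      using conn v that W by (intro connected_distinct_path) (auto simp: connected_graph_def)
    then obtain P where P: "\<And>w. w \<in> W \<Longrightarrow> P w \<noteq> [] \<and> hd (P w) = v \<and> last (P w) = w \<and>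
        successively (adjacent E) (P w) \<and> distinct (P w)"
      by metis
    \<comment> \<open>The representative that attains the maximum may vary with \<open>n\<close>, so
      \<open>l\<close> bounds the paths to all representatives at once.\<close>
    define l where "l = Max ((length \<circ> P) ` W)"
    let ?t = "\<lambda>n i k. saw_count E v (i + (2 * n - k)) * saw_count E v (i + k)"
    have doubling: "A (2 * n) \<le> (\<Sum>i<l. \<Sum>k\<le>2 * n. ?t n i k)" for n
    proof -
      obtain w where w: "w \<in> W" "A (2 * n) = saw_count E w (2 * n)" using attained by blast
      have "A (2 * n) \<le> (\<Sum>i<length (P w). \<Sum>k\<le>2 * n. ?t n i k)"
        unfolding w(2) using P[OF w(1)] by (intro saw_count_change_start[OF sg fin v]) auto
      also have "\<dots> \<le> (\<Sum>i<l. \<Sum>k\<le>2 * n. ?t n i k)"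
        using w W by (intro sum_mono2) (auto simp: l_def Max_ge_iff less_le_trans)
      finally show ?thesis .
    qed
    show ?thesis
    proof (rule Hammersley_limit[where A = "\<lambda>n. real (A n)" and l = l])
      show "real (A (m + n)) \<le> real (A m) * real (A n)" for m n
        using Asub[of m n] by (metis of_nat_le_iff of_nat_mult)
      show "1 \<le> real (A n)" for n using A1[of n] by simp
      show "1 \<le> real (saw_count E v n)" for n using pos[OF v, of n] by simp
      show "real (saw_count E v n) \<le> real (A n)" for n using le_A[OF v] by simp
      show "real (saw_count E v (m + n)) \<le> real (saw_count E v m) * real (A n)" for m n
        using sub[OF v, of m n] by (metis of_nat_le_iff of_nat_mult)
      show "real (A (2 * n)) \<le> (\<Sum>i<l. \<Sum>k\<le>2 * n.
          real (saw_count E v (i + (2 * n - k))) * real (saw_count E v (i + k)))" for n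
        using doubling[of n] by (simp flip: of_nat_mult of_nat_sum)
    qed (use L in auto)
  qed
  then show ?thesis by blast
qed

text \<open>The vertex \<open>v\<close> makes the definite description meaningful: over an empty
  vertex set every number would satisfy it.\<close>

lemma connective_constant_limit:
  assumes "Q3 V E r" "\<And>v n. v \<in> V \<Longrightarrow> saw_count E v n \<noteq> 0" "v \<in> V"
  shows "(\<lambda>n. root n (real (saw_count E v n))) \<longlonglongrightarrow> connective_constant V E"
proof -
  obtain \<mu> where \<mu>: "\<forall>v\<in>V. (\<lambda>n. root n (real (saw_count E v n))) \<longlonglongrightarrow> \<mu>"
    using connective_constant_exists[OF assms(1,2)] by blast
  then have "connective_constant V E = \<mu>"
    unfolding connective_constant_def
    using LIMSEQ_unique assms(3) by (intro the_equality) blast+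
  with \<mu> assms(3) show ?thesis by simp
qed

section \<open>Fibonacci families of walks\<close>

text \<open>Both kinds of block begin with an \<open>m\<close>-step, so there is one walk of one
  step; it may be a block of length 2 broken off. The counts thus start with 1, 1.\<close>

fun golden_walks :: "('a \<Rightarrow> 'a) \<Rightarrow> ('a \<Rightarrow> 'a) \<Rightarrow> nat \<Rightarrow> 'a \<Rightarrow> 'a list set" where
  "golden_walks m Q 0 u = {[u]}"
| "golden_walks m Q (Suc 0) u = {[u, m u]}"
| "golden_walks m Q (Suc (Suc n)) u =
    Cons u ` golden_walks m Q (Suc n) (m u) \<union> (\<lambda>p. u # m u # p) ` golden_walks m Q n (Q u)"

text \<open>The local form of golden walks, which is inherited by every subwalk that starts with an
  \<open>m\<close>-step.\<close>

definition golden_step :: "('a \<Rightarrow> 'a) \<Rightarrow> ('a \<Rightarrow> 'a) \<Rightarrow> (nat \<Rightarrow> 'a) \<Rightarrow> nat \<Rightarrow> bool" where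
  "golden_step m Q x i \<longleftrightarrow> x (Suc i) = m (x i) \<or>
    (\<exists>j. i = Suc j \<and> x i = m (x j) \<and> x (Suc i) = Q (x j))"

lemma golden_walks_length: "p \<in> golden_walks m Q n u \<Longrightarrow> length p = Suc n \<and> hd p = u"
  by (induction m Q n u arbitrary: p rule: golden_walks.induct) fastforce+

lemma golden_walks_step:
  "p \<in> golden_walks m Q n u \<Longrightarrow> i < n \<Longrightarrow> golden_step m Q ((!) p) i"
proof (induction m Q n u arbitrary: p i rule: golden_walks.induct)
  case (3 m Q n u)
  show ?case
  proof (cases "p \<in> Cons u ` golden_walks m Q (Suc n) (m u)")
    case True
    then obtain q where q: "p = u # q" "q \<in> golden_walks m Q (Suc n) (m u)" by blast
    then have "q ! 0 = m u" using golden_walks_length by (metis hd_conv_nth list.size(3) nat.distinct(1))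
    then show ?thesis
      using q 3(1)[OF q(2), of "i - 1"] 3(4) by (cases i) (auto simp: golden_step_def)
  next
    case False
    then obtain q where q: "p = u # m u # q" "q \<in> golden_walks m Q n (Q u)" using 3(3) by auto
    then have q0: "q ! 0 = Q u" using golden_walks_length by (metis hd_conv_nth list.size(3) nat.distinct(1))
    show ?thesis
    proof (cases i)
      case 0
      then show ?thesis using q by (simp add: golden_step_def)
    next
      case (Suc j)
      then show ?thesis
        using q q0 3(2)[OF q(2), of "j - 1"] 3(4) by (cases j) (auto simp: golden_step_def)
    qed
  qed
qed (auto simp: golden_step_def)

section \<open>Golden walks avoid themselves\<close>

locale ascending_choice =
  fixes V :: "'a set" and E :: "'a set set" and h :: "'a \<Rightarrow> real" and m :: "'a \<Rightarrow> 'a"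
  assumes simple: "simple_graph V E" and cubic: "cubic V E" and choice: "admissible_choice V E h m"
    and Q_up: "u \<in> V \<Longrightarrow> h u < h (qm E m u)"
    and mQ_up: "u \<in> V \<Longrightarrow> h (m u) < h (m (qm E m u))"
begin

abbreviation "Q \<equiv> qm E m"

lemma m_adjacent: "u \<in> V \<Longrightarrow> adjacent E u (m u)"
  using choice by (simp add: admissible_choice_def maximal_neighbour_def neighbours_def)

lemma m_mem: "u \<in> V \<Longrightarrow> m u \<in> V"
  using m_adjacent adjacent_mem[OF simple] by blast

lemma m_max: "u \<in> V \<Longrightarrow> adjacent E u x \<Longrightarrow> h x \<le> h (m u)"
  using choice by (auto simp: admissible_choice_def maximal_neighbour_def neighbours_def)

lemma mm_neq: "u \<in> V \<Longrightarrow> m (m u) \<noteq> u"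
  using choice by (simp add: admissible_choice_def)

lemma Q_third: "u \<in> V \<Longrightarrow> adjacent E (m u) (Q u) \<and> Q u \<noteq> u \<and> Q u \<noteq> m (m u)"
  using theI'[OF qm_well_defined[OF simple cubic choice, of u]] by (simp add: qm_def neighbours_def)

lemma Q_mem: "u \<in> V \<Longrightarrow> Q u \<in> V"
  using Q_third adjacent_mem[OF simple] by blast

lemma Q_unique: "u \<in> V \<Longrightarrow> adjacent E (m u) w \<Longrightarrow> w \<noteq> u \<Longrightarrow> w \<noteq> m (m u) \<Longrightarrow> w = Q u"
  using qm_well_defined[OF simple cubic choice, of u] Q_third by (auto simp: neighbours_def)

text \<open>\<open>Q u\<close> competes with \<open>m (m u)\<close> among the neighbours of
  \<open>m u\<close>, so \<open>m (m u)\<close> is at least as high.\<close>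

lemma mm_up: "u \<in> V \<Longrightarrow> h u < h (m (m u))"
  using m_max[OF m_mem, of u "Q u"] Q_third[of u] Q_up[of u] by simp

text \<open>The intermediate vertices \<open>m u\<close> need not lie above \<open>u\<close>: only every second step ascends.\<close>

lemma two_steps_up:
  assumes "x i \<in> V" "golden_step m Q x i" "golden_step m Q x (Suc i)"
    and "\<And>j. i = Suc j \<Longrightarrow> x j \<in> V"
  shows "h (x i) < h (x (Suc (Suc i)))"
proof (cases "x (Suc i) = m (x i)")
  case True
  then show ?thesis using assms mm_up Q_up by (auto simp: golden_step_def)
next
  \<comment> \<open>A \<open>Q\<close>-step must follow an \<open>m\<close>-step, so the step after
    a \<open>Q\<close>-step is an \<open>m\<close>-step, and \<open>mQ_up\<close> compares the two
    ends.\<close>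
  case False
  then obtain j where "i = Suc j" "x i = m (x j)" "x (Suc i) = Q (x j)"
    using assms(2) by (auto simp: golden_step_def)
  then show ?thesis using assms False mQ_up[of "x j"] by (auto simp: golden_step_def)
qed

text \<open>Along the periodic repetition \<open>h\<close> would rise in every two steps, yet the
  start recurs after an even number of them.\<close>

lemma no_closed_walk:
  assumes V: "\<And>k. k \<le> n \<Longrightarrow> x k \<in> V" and step: "\<And>k. k < n \<Longrightarrow> golden_step m Q x k"
    and ij: "i < j" "j \<le> n" "x (Suc i) = m (x i)"
  shows "x i \<noteq> x j"
proof
  assume closed: "x i = x j"
  define l where "l = j - i"
  have l: "l > 0" "j = i + l" using ij by (auto simp: l_def)
  \<comment> \<open>A closed walk that starts with an \<open>m\<close>-step can be run through periodically.\<close>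
  define y where "y k = x (i + k mod l)" for k
  have yV: "y k \<in> V" for k
    using ij l mod_less_divisor[of l k] unfolding y_def by (intro V) linarith
  have y_Suc: "y (Suc k) = x (Suc (i + k mod l))" for k
    using closed l by (auto simp: y_def mod_Suc simp flip: add_Suc_right)
  \<comment> \<open>At a seam between periods the step is the \<open>m\<close>-step assumed at
    \<open>i\<close>, so nothing is asked of its predecessor; elsewhere the predecessor lies in the
    same period.\<close>
  have ystep: "golden_step m Q y k" for k
  proof (cases "k mod l = 0")
    case True
    then show ?thesis using ij y_Suc by (simp add: golden_step_def y_def)
  next
    case False
    then obtain k' where k: "k = Suc k'" by (cases k) auto
    have "k mod l = Suc (k' mod l)" using False k by (auto simp: mod_Suc split: if_splits)
    moreover have "golden_step m Q x (i + k mod l)"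
      using ij l mod_less_divisor[of l k] by (intro step) linarith
    ultimately show ?thesis
      unfolding golden_step_def y_Suc unfolding y_def k by auto
  qed
  have "h (y 0) < h (y (2 * Suc k))" for k
  proof (induction k)
    case 0
    show ?case using two_steps_up[of y 0, OF yV ystep ystep yV] by (simp add: numeral_2_eq_2)
  next
    case (Suc k)
    then show ?case using two_steps_up[of y "2 * Suc k", OF yV ystep ystep yV] by simp
  qed
  \<comment> \<open>Two periods have an even number of steps whatever the parity of
    \<open>l\<close>.\<close>
  from this[of "l - 1"] show False using l by (simp add: y_def)
qed

text \<open>By \<open>no_closed_walk\<close> a return must start with a \<open>Q\<close>-step, so
  the repeated vertex is some \<open>m (x k)\<close>. The vertex \<open>x l\<close> before the
  return is one of its three neighbours: \<open>x (Suc i)\<close> is excluded by induction,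
  \<open>x k\<close> would close a walk that starts with an \<open>m\<close>-step, and
  \<open>m (m (x k))\<close> leads to a 2-cycle of \<open>Q\<close>.\<close>

lemma golden_distinct:
  assumes V: "\<And>k. k \<le> n \<Longrightarrow> x k \<in> V" and step: "\<And>k. k < n \<Longrightarrow> golden_step m Q x k"
    and "i < j" "j \<le> n"
  shows "x i \<noteq> x j"
  using \<open>i < j\<close> \<open>j \<le> n\<close>
proof (induction "j - i" arbitrary: i j rule: less_induct)
  case less
  have adj: "adjacent E (x k) (x (Suc k))" if "k < n" for k
    using step[OF that] m_adjacent Q_third V that by (auto simp: golden_step_def)
  show ?case
  proof
    assume closed: "x i = x j"
    have ne: "j \<noteq> Suc i"
      using adj[of i] closed less.prems adjacent_mem(3)[OF simple] by auto
    have "x (Suc i) \<noteq> m (x i)"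
      using no_closed_walk[OF V step] less.prems closed by blast
    then obtain k where k: "i = Suc k" "x i = m (x k)" "x (Suc i) = Q (x k)"
      using step[of i] less.prems by (auto simp: golden_step_def)
    obtain l where l: "j = Suc l" "Suc i \<le> l" using ne less.prems by (cases j) auto
    \<comment> \<open>In this case \<open>l\<close> is \<open>Suc i\<close>, and the induction
      hypothesis could not separate \<open>x l\<close> from \<open>x (Suc i)\<close>.\<close>
    have ne2: "j \<noteq> Suc (Suc i)"
    proof
      assume "j = Suc (Suc i)"
      then have "h (x i) < h (x j)"
        using two_steps_up[of x i] V step less.prems k by simp
      with closed show False by simp
    qed
    then have li: "Suc i < l" using l by linarith
    have xV: "x k \<in> V" "x l \<in> V" using V k l less.prems by auto
    have "x (Suc i) \<noteq> x l" using less.hyps[of l "Suc i"] li l less.prems by simp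
    moreover have "adjacent E (m (x k)) (x l)"
      using adj[of l] l less.prems closed k adjacent_sym by (metis Suc_le_lessD)
    ultimately have "x l = x k \<or> x l = m (m (x k))" using Q_unique[OF xV(1)] k by metis
    then show False
    proof
      assume "x l = x k"
      moreover have "x k \<noteq> x l" using k li l less.prems by (intro no_closed_walk[OF V step]) auto
      ultimately show False by simp
    next
      assume xl: "x l = m (m (x k))"
      have mV: "m (x k) \<in> V" using xV m_mem by blast
      \<comment> \<open>An \<open>m\<close>-step here would make \<open>m\<close> exchange
        \<open>m (x k)\<close> and \<open>x l\<close>, so the last step is a
        \<open>Q\<close>-step.\<close>
      have "x j \<noteq> m (x l)" using mm_neq[OF mV] closed k xl by simp
      then obtain l' where l': "l = Suc l'" "x l = m (x l')" "x j = Q (x l')"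
        using step[of l] l less.prems by (auto simp: golden_step_def)
      have yV: "x l' \<in> V" using V l l' less.prems by auto
      \<comment> \<open>Now \<open>Q (Q (x l')) = x l'\<close>, which contradicts \<open>Q_up\<close>.\<close>
      have eq: "Q (x l') = m (x k)" "m (m (x k)) = m (x l')" using l' closed k xl by simp_all
      have "x l' = Q (m (x k))"
      proof (rule Q_unique[OF mV])
        show "adjacent E (m (m (x k))) (x l')"
          using m_adjacent[OF yV] eq adjacent_sym by metis
        show "x l' \<noteq> m (x k)" using Q_third[OF yV] eq by metis
        show "x l' \<noteq> m (m (m (x k)))" using mm_neq[OF yV] eq by metis
      qed
      then have "h (m (x k)) < h (x l')" using Q_up[OF mV] by simp
      moreover have "h (x l') < h (m (x k))" using Q_up[OF yV] eq by simp
      ultimately show False by simp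
    qed
  qed
qed

lemma golden_walks_mem: "u \<in> V \<Longrightarrow> p \<in> golden_walks m Q n u \<Longrightarrow> set p \<subseteq> V"
proof (induction n arbitrary: u p rule: less_induct)
  case (less n)
  consider "n = 0" | "n = 1" | k where "n = Suc (Suc k)" by (metis One_nat_def not0_implies_Suc)
  then show ?case
  proof cases
    case (3 k)
    then show ?thesis
      using less.prems less.IH[of "Suc k" "m u"] less.IH[of k "Q u"] m_mem Q_mem by fastforce
  qed (use less.prems m_mem in auto)
qed

lemma golden_walks_saws:
  assumes "u \<in> V"
  shows "golden_walks m Q n u \<subseteq> saws E u n"
proof
  fix p assume p: "p \<in> golden_walks m Q n u"
  have len: "length p = Suc n" "hd p = u" using golden_walks_length[OF p] by auto
  have V: "p ! k \<in> V" if "k \<le> n" for k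
    using golden_walks_mem[OF assms p] nth_mem[of k p] len that by auto
  have step: "golden_step m Q ((!) p) k" if "k < n" for k
    using golden_walks_step[OF p that] .
  have "distinct p"
    unfolding distinct_conv_nth
  proof (intro allI impI)
    fix i j assume "i < length p" "j < length p" "i \<noteq> j"
    then show "p ! i \<noteq> p ! j"
      using golden_distinct[of n "(!) p", OF V step] len by (metis less_Suc_eq_le linorder_neqE_nat)
  qed
  moreover have "successively (adjacent E) p"
  proof -
    have "adjacent E (p ! k) (p ! Suc k)" if "k < n" for k
      using step[OF that] m_adjacent Q_third V that by (auto simp: golden_step_def)
    then show ?thesis using len by (simp add: successively_conv_nth)
  qed
  ultimately show "p \<in> saws E u n" using len by (simp add: saws_def)
qed

section \<open>Counting golden walks\<close>

lemma finite_saws_Q: "u \<in> V \<Longrightarrow> finite (saws E u n)"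
  using finite_saws[OF simple cubic_neighbours_finite[OF cubic]] .

text \<open>The two families differ in their third vertex: a walk of at least one step from
  \<open>m u\<close> begins with an \<open>m\<close>-step, so there it is \<open>m (m u)\<close>,
  against \<open>Q u\<close> in the other family.\<close>

lemma card_golden_walks_Suc_Suc:
  assumes u: "u \<in> V"
  shows "card (golden_walks m Q (Suc (Suc n)) u) =
    card (golden_walks m Q (Suc n) (m u)) + card (golden_walks m Q n (Q u))"
proof -
  have fin: "finite (golden_walks m Q k w)" if "w \<in> V" for k w
    using golden_walks_saws[OF that] finite_saws_Q[OF that] finite_subset by blast
  have "Cons u ` golden_walks m Q (Suc n) (m u) \<inter> (\<lambda>p. u # m u # p) ` golden_walks m Q n (Q u) = {}"
  proof (rule ccontr)
    assume "\<not> ?thesis"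
    then obtain p where p: "m u # p \<in> golden_walks m Q (Suc n) (m u)" "p \<in> golden_walks m Q n (Q u)"
      by auto
    have "golden_step m Q ((!) (m u # p)) 0" using golden_walks_step[OF p(1)] by simp
    then have "p ! 0 = m (m u)" by (simp add: golden_step_def)
    moreover have "p ! 0 = Q u"
      using golden_walks_length[OF p(2)] by (metis hd_conv_nth list.size(3) nat.distinct(1))
    ultimately show False using Q_third[OF u] by simp
  qed
  then show ?thesis
    using fin u m_mem Q_mem by (simp add: card_Un_disjoint card_image inj_on_def)
qed

text \<open>The factor \<phi> on the right is what the single walk of one step requires; the
  equation for \<phi> then matches the Fibonacci recursion.\<close>

lemma card_golden_walks:
  fixes \<phi> :: real
  assumes \<phi>: "\<phi> \<ge> 1" "\<phi>\<^sup>2 = \<phi> + 1" and "u \<in> V"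
  shows "\<phi> ^ n \<le> \<phi> * real (card (golden_walks m Q n u))"
  using \<open>u \<in> V\<close>
proof (induction n arbitrary: u rule: less_induct)
  case (less n)
  consider "n = 0" | "n = 1" | k where "n = Suc (Suc k)" by (metis One_nat_def not0_implies_Suc)
  then show ?case
  proof cases
    case (3 k)
    have "\<phi> ^ n = \<phi> ^ k * \<phi>\<^sup>2" by (simp add: 3 power2_eq_square)
    also have "\<dots> = \<phi> ^ Suc k + \<phi> ^ k" by (simp add: \<phi>(2) algebra_simps)
    also have "\<dots> \<le> \<phi> * real (card (golden_walks m Q (Suc k) (m u)))
        + \<phi> * real (card (golden_walks m Q k (Q u)))"
      using less.prems m_mem Q_mem by (intro add_mono less.IH) (auto simp: 3)
    finally show ?thesis
      unfolding 3 card_golden_walks_Suc_Suc[OF less.prems] by (simp add: algebra_simps)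
  qed (use \<phi> in auto)
qed

theorem connective_constant_ge_golden_mean:
  assumes G: "Q3 V E r"
  shows "connective_constant V E \<ge> (1 + sqrt 5) / 2"
proof -
  define \<phi> :: real where "\<phi> = (1 + sqrt 5) / 2"
  have "sqrt 5 \<ge> sqrt 1" by (intro real_sqrt_le_mono) simp
  then have \<phi>: "\<phi> \<ge> 1" "\<phi>\<^sup>2 = \<phi> + 1"
    by (simp_all add: \<phi>_def power2_eq_square field_simps)
  have low: "\<phi> ^ n \<le> \<phi> * real (saw_count E u n)" if "u \<in> V" for u n
  proof -
    have "card (golden_walks m Q n u) \<le> saw_count E u n"
      unfolding saw_count_def using golden_walks_saws that finite_saws_Q by (intro card_mono)
    then have "\<phi> * real (card (golden_walks m Q n u)) \<le> \<phi> * real (saw_count E u n)"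
      using \<phi> by (intro mult_left_mono) auto
    with card_golden_walks[OF \<phi> that, of n] show ?thesis by linarith
  qed
  have r: "r \<in> V" using G by (simp add: Q3_def)
  \<comment> \<open>The lower bound also supplies the positivity on which the existence of the limit
    rests.\<close>
  have "saw_count E u n \<noteq> 0" if "u \<in> V" for u n
    using low[OF that, of n] \<phi>(1) by (metis mult_zero_right not_one_le_zero of_nat_0 one_le_power order_trans)
  then have lim: "(\<lambda>n. root n (real (saw_count E r n))) \<longlonglongrightarrow> connective_constant V E"
    using connective_constant_limit[OF G] r by blast
  \<comment> \<open>The constant factor disappears under the \<open>n\<close>-th root.\<close>
  have "(\<lambda>n. root n (1 / \<phi>) * \<phi>) \<longlonglongrightarrow> 1 * \<phi>"
    using \<phi> by (intro tendsto_intros LIMSEQ_root_const) auto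
  moreover have "root n (1 / \<phi>) * \<phi> \<le> root n (real (saw_count E r n))" if "n > 0" for n
  proof -
    have "root n (1 / \<phi>) * \<phi> = root n (1 / \<phi>) * root n (\<phi> ^ n)"
      using \<phi> that by (simp add: real_root_power_cancel)
    also have "\<dots> = root n (\<phi> ^ n / \<phi>)" by (simp flip: real_root_mult)
    also have "\<dots> \<le> root n (real (saw_count E r n))"
      using low[OF r, of n] \<phi> that by (intro real_root_le_mono) (auto simp: field_simps)
    finally show ?thesis .
  qed
  then have "\<forall>\<^sub>F n in sequentially. root n (1 / \<phi>) * \<phi> \<le> root n (real (saw_count E r n))"
    using eventually_gt_at_top[of 0] by (rule eventually_mono[rotated])
  ultimately have "1 * \<phi> \<le> connective_constant V E"
    by (intro tendsto_le[OF sequentially_bot lim])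
  then show ?thesis by (simp add: \<phi>_def)
qed

end

section \<open>Sources of ascending choices\<close>

text \<open>Harmonicity at \<open>m u\<close> turns the left side of the hypothesis into
  \<open>h (m u) - h (qm E m u)\<close>. Comparing it with the two entries of the minimum gives
  exactly the two inequalities of the locale.\<close>

lemma harmonic_ascending_choice:
  assumes G: "simple_graph V E" "cubic V E" and harm: "harmonic V E h"
    and choice: "admissible_choice V E h m"
    and incr: "\<And>u. u \<in> V \<Longrightarrow>
      max_incr h m (m u) - max_incr h m u < min (max_incr h m u) (max_incr h m (qm E m u))"
  shows "ascending_choice V E h m"
proof -
  have *: "h u < h (qm E m u) \<and> h (m u) < h (m (qm E m u))" if u: "u \<in> V" for u
  proof -
    let ?v = "m u"
    have ne: "m ?v \<noteq> u" and adj: "adjacent E u ?v"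
      using choice u by (auto simp: admissible_choice_def maximal_neighbour_def neighbours_def)
    have v: "?v \<in> V" using adj adjacent_mem[OF G(1)] by blast
    have q: "qm E m u \<in> neighbours E ?v \<and> qm E m u \<noteq> u \<and> qm E m u \<noteq> m ?v"
      unfolding qm_def by (rule theI'[OF qm_well_defined[OF G choice u]])
    have "u \<in> neighbours E ?v" using adj by (simp add: neighbours_def adjacent_sym)
    moreover have "m ?v \<in> neighbours E ?v"
      using choice v by (simp add: admissible_choice_def maximal_neighbour_def)
    moreover have "card (neighbours E ?v) = 3" using G(2) v by (simp add: cubic_def)
    moreover have "card {u, m ?v, qm E m u} = 3" using ne q by auto
    moreover have "finite (neighbours E ?v)" using cubic_neighbours_finite[OF G(2) v] .
    ultimately have N: "neighbours E ?v = {u, m ?v, qm E m u}"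
      using q by (intro card_subset_eq[symmetric]) auto
    have "h ?v = 1 / 3 * (h u + (h (m ?v) + h (qm E m u)))"
      using harm v ne q unfolding harmonic_def by (auto simp: N)
    then show ?thesis using incr[OF u] by (auto simp: max_incr_def)
  qed
  then show ?thesis using G choice by unfold_locales auto
qed

section \<open>Transitive graphs and height functions\<close>

lemma acts_transitively_imp_one_orbit:
  assumes "acts_transitively V H" "H \<subseteq> carrier (aut_group V E)"
  shows "finitely_many_orbits V E H"
proof -
  have "{\<alpha> x | \<alpha>. \<alpha> \<in> H} = V" if "x \<in> V" for x
  proof
    show "{\<alpha> x | \<alpha>. \<alpha> \<in> H} \<subseteq> V"
      using assms(2) that by (auto simp: aut_group_def Bij_def bij_betw_def)
    show "V \<subseteq> {\<alpha> x | \<alpha>. \<alpha> \<in> H}"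
    proof
      fix y assume "y \<in> V"
      then have "\<exists>\<alpha>\<in>H. \<alpha> x = y" using assms(1) that by (simp add: acts_transitively_def)
      then show "y \<in> {\<alpha> x | \<alpha>. \<alpha> \<in> H}" by fastforce
    qed
  qed
  then have "orbits (aut_group V E\<lparr>carrier := H\<rparr>) V (\<lambda>\<alpha>. \<alpha>) \<subseteq> {V}"
    by (auto simp: orbits_def orbit_def)
  then show ?thesis unfolding finitely_many_orbits_def by (rule finite_subset) simp
qed


text \<open>By transitivity every vertex sees the same three increments of \<open>h\<close>: the
  maximum \<open>d\<close>, its negative, and a third one. Up to sign only one neighbour of a vertex
  is lower, by \<open>d\<close>. At \<open>m u\<close> this neighbour is \<open>u\<close>, so
  \<open>Q\<close> never descends from \<open>m u\<close>.\<close>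

lemma transitive_height_ascending_choice:
  assumes G: "G3 V E r" and H: "transitive_graph_height_function V E r h H"
  shows "\<exists>(f :: 'a \<Rightarrow> real) m. ascending_choice V E f m"
proof -
  have sg: "simple_graph V E" and cub: "cubic V E" and r: "r \<in> V" using G by (auto simp: G3_def)
  have NV: "x \<in> V" if "x \<in> neighbours E v" for x v using neighbours_mem[OF sg that] .
  have Nsym: "x \<in> neighbours E v \<longleftrightarrow> v \<in> neighbours E x" for x v
    by (simp add: neighbours_def adjacent_sym)
  have HA: "H \<subseteq> carrier (aut_group V E)"
    using H by (auto simp: transitive_graph_height_function_def graph_height_function_def
        dest: subgroup.subset)
  have move: "\<exists>\<alpha>. inj_on \<alpha> V \<and> \<alpha> u = v \<and>
      (\<forall>x\<in>neighbours E u. \<alpha> x \<in> neighbours E v \<and> h (\<alpha> x) - h v = h x - h u)"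
    if "u \<in> V" "v \<in> V" for u v
  proof -
    have "\<exists>\<alpha>\<in>H. \<alpha> u = v"
      using H that by (simp add: transitive_graph_height_function_def acts_transitively_def)
    then obtain \<alpha> where \<alpha>: "\<alpha> \<in> H" "\<alpha> u = v" by (rule bexE)
    have "inj_on \<alpha> V" "\<And>x y. x \<in> V \<Longrightarrow> y \<in> V \<Longrightarrow> adjacent E (\<alpha> x) (\<alpha> y) \<longleftrightarrow> adjacent E x y"
      using \<alpha> HA by (auto simp: aut_group_def Bij_def bij_betw_def)
    moreover have "\<And>x y. x \<in> V \<Longrightarrow> y \<in> V \<Longrightarrow> h (\<alpha> y) - h (\<alpha> x) = h y - h x"
      using H \<alpha> by (auto simp: transitive_graph_height_function_def graph_height_function_def)
    ultimately show ?thesis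
      using \<alpha> NV that by (intro exI[of _ \<alpha>]) (auto simp: neighbours_def)
  qed
  have fin: "finite (neighbours E r)" using cubic_neighbours_finite[OF cub r] .
  obtain up where up: "up \<in> neighbours E r" "h r < h up"
    using H r by (auto simp: transitive_graph_height_function_def graph_height_function_def)
  have "Max (h ` neighbours E r) \<in> h ` neighbours E r" using up(1) fin by (intro Max_in) auto
  then obtain a where a: "a \<in> neighbours E r" "Max (h ` neighbours E r) = h a" by blast
  have a_max: "h x \<le> h a" if "x \<in> neighbours E r" for x
    using that fin by (simp flip: a(2))
  define d where "d = h a - h r"
  have d: "d > 0" using up a_max by (force simp: d_def)
  have le: "h x \<le> h v + d" if "x \<in> neighbours E v" for x v
  proof -
    have "v \<in> V" using that Nsym NV by blast
    then obtain \<alpha> where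
      "\<forall>x\<in>neighbours E v. \<alpha> x \<in> neighbours E r \<and> h (\<alpha> x) - h r = h x - h v"
      using move[OF _ r] by blast
    then have "\<alpha> x \<in> neighbours E r" "h (\<alpha> x) - h r = h x - h v" using that by simp_all
    then show ?thesis using a_max[of "\<alpha> x"] by (simp add: d_def)
  qed
  have ge: "h v - d \<le> h x" if "x \<in> neighbours E v" for x v
    using le[of v x] that Nsym by force
  have aV: "a \<in> V" using a NV by blast
  \<comment> \<open>Seen from \<open>a\<close> the edge to \<open>r\<close> has increment
    \<open>- d\<close>; an element of \<open>H\<close> that takes \<open>a\<close> to
    \<open>r\<close> carries this edge to the edge from \<open>r\<close> to
    \<open>b\<close>.\<close>
  obtain b where b: "b \<in> neighbours E r" "h b = h r - d"
  proof -
    obtain \<alpha> where "\<forall>x\<in>neighbours E a. \<alpha> x \<in> neighbours E r \<and> h (\<alpha> x) - h r = h x - h a"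
      using move[OF aV r] by blast
    then show thesis using that[of "\<alpha> r"] a Nsym by (force simp: d_def)
  qed
  have "a \<noteq> b" using b d by (auto simp: d_def)
  then have "card (neighbours E r - {a, b}) = 1"
    using a b cub r by (subst card_Diff_subset) (auto simp: cubic_def)
  then obtain c where c: "neighbours E r - {a, b} = {c}" by (auto simp: card_1_singleton_iff)
  then have Nr: "neighbours E r = {a, b, c}" "c \<noteq> a" "c \<noteq> b" using a b by auto
  \<comment> \<open>The set of increments at a vertex does not depend on the vertex, hence is closed under
    negation.\<close>
  have third: "h c = h r - d \<or> h c = h r \<or> h c = h r + d"
  proof -
    have "c \<in> V" using Nr NV by blast
    then obtain \<alpha> where "\<forall>x\<in>neighbours E c. \<alpha> x \<in> neighbours E r \<and> h (\<alpha> x) - h r = h x - h c"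
      using move[OF _ r] by blast
    then have "\<alpha> r \<in> {a, b, c}" "h (\<alpha> r) - h r = h r - h c" using Nr Nsym[of r c] by auto
    then show ?thesis using b by (auto simp: d_def)
  qed
  have nbrs: "\<exists>x y z. neighbours E v = {x, y, z} \<and> h x = h v + d \<and> h y = h v - d \<and> h z - h v = h c - h r"
    if v: "v \<in> V" for v
  proof -
    obtain \<alpha> where \<alpha>: "inj_on \<alpha> V"
      "\<forall>x\<in>neighbours E r. \<alpha> x \<in> neighbours E v \<and> h (\<alpha> x) - h v = h x - h r"
      using move[OF r v] by blast
    have "neighbours E r \<subseteq> V" using NV by blast
    then have "card (\<alpha> ` neighbours E r) = 3"
      using \<alpha>(1) cub r by (metis card_image cubic_def inj_on_subset)
    moreover have "card (neighbours E v) = 3" using cub v by (simp add: cubic_def)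
    ultimately have "\<alpha> ` neighbours E r = neighbours E v"
      using \<alpha>(2) cubic_neighbours_finite[OF cub v] by (intro card_subset_eq) auto
    then have "neighbours E v = {\<alpha> a, \<alpha> b, \<alpha> c}" by (simp add: Nr)
    moreover have "h (\<alpha> a) = h v + d" "h (\<alpha> b) = h v - d" "h (\<alpha> c) - h v = h c - h r"
      using bspec[OF \<alpha>(2), of a] bspec[OF \<alpha>(2), of b] bspec[OF \<alpha>(2), of c] b(2)
      by (simp_all add: Nr(1) d_def)
    ultimately show ?thesis by blast
  qed
  \<comment> \<open>If two of the three increments are \<open>- d\<close>, then turn \<open>h\<close> upside down.\<close>
  define s :: int where "s = (if h c = h r - d then - 1 else 1)"
  define f where "f x = s * h x" for x
  have f: "\<exists>x y z. neighbours E v = {x, y, z} \<and> f x = f v + d \<and> f y = f v - d \<and>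
      f v \<le> f z \<and> f z \<le> f v + d" if v: "v \<in> V" for v
  proof -
    obtain x y z where xyz: "neighbours E v = {x, y, z}" "h x = h v + d" "h y = h v - d"
      "h z - h v = h c - h r" using nbrs[OF v] by blast
    show ?thesis
    proof (cases "h c = h r - d")
      case True
      then have "f w = - h w" for w by (simp add: f_def s_def)
      then show ?thesis
        using xyz d True by (intro exI[of _ y] exI[of _ x] exI[of _ z]) auto
    next
      case False
      then have "f = h" "h c = h r \<or> h c = h r + d" using third by (auto simp: f_def s_def)
      then show ?thesis
        using xyz d by (intro exI[of _ x] exI[of _ y] exI[of _ z]) auto
    qed
  qed
  have "\<exists>x\<in>neighbours E v. f x = f v + d" if "v \<in> V" for v using f[OF that] by blast
  then obtain m where m: "\<And>v. v \<in> V \<Longrightarrow> m v \<in> neighbours E v" "\<And>v. v \<in> V \<Longrightarrow> f (m v) = f v + d"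
    by metis
  have fmax: "f x \<le> f v + d" if "v \<in> V" "x \<in> neighbours E v" for x v
    using f[OF that(1)] that(2) d by force
  have choice: "admissible_choice V E (real_of_int \<circ> f) m"
    unfolding admissible_choice_def maximal_neighbour_def
  proof (intro conjI ballI)
    fix u assume u: "u \<in> V"
    show "m u \<in> neighbours E u" using m u by blast
    show "(real_of_int \<circ> f) x - (real_of_int \<circ> f) u \<le> (real_of_int \<circ> f) (m u) - (real_of_int \<circ> f) u"
      if "x \<in> neighbours E u" for x
      using fmax[OF u that] m(2)[OF u] by simp
    have "f (m (m u)) = f u + d + d" using m u NV by metis
    then show "m (m u) \<noteq> u" using d by auto
  qed
  have "f (m u) \<le> f (qm E m u) \<and> qm E m u \<in> V" if u: "u \<in> V" for u
  proof -
    have mu: "m u \<in> V" using m u NV by blast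
    have q: "qm E m u \<in> neighbours E (m u) \<and> qm E m u \<noteq> u \<and> qm E m u \<noteq> m (m u)"
      unfolding qm_def by (rule theI'[OF qm_well_defined[OF sg cub choice u]])
    obtain x y z where xyz: "neighbours E (m u) = {x, y, z}" "f x = f (m u) + d" "f y = f (m u) - d"
      "f (m u) \<le> f z" using f[OF mu] by blast
    have "u \<in> {x, y, z}" using m(1)[OF u] Nsym xyz by metis
    \<comment> \<open>The other two neighbours of \<open>m u\<close> are not below
      \<open>m u\<close>, whereas \<open>u\<close> is.\<close>
    then have "u = y" using xyz m(2)[OF u] d by auto
    then show ?thesis using q xyz d NV by auto
  qed
  \<comment> \<open>Every \<open>m\<close>-step climbs by \<open>d\<close>, so
    \<open>f u < f (m u) <= f (qm E m u) < f (m (qm E m u))\<close>.\<close>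
  then have "ascending_choice V E (real_of_int \<circ> f) m"
    using sg cub choice m d by unfold_locales fastforce+
  then show ?thesis by blast
qed

section \<open>The four cases\<close>

theorem theorem3p1:
  fixes V :: "'a set" and E :: "'a set set" and r :: 'a
  assumes
    "(Q3 V E r \<and>
        (\<exists>h m. harmonic V E h \<and> admissible_choice V E h m \<and>
          (\<forall>u\<in>V.
             max_incr h m (m u) - max_incr h m u
               < min (max_incr h m u) (max_incr h m (qm E m u)) \<and>
             2 * max_incr h m (qm E m u)
               > max_incr h m (m u) - max_incr h m u + max_incr h m (m (qm E m u)))))
     \<or>
     (G3 V E r \<and> (\<exists>h H. transitive_graph_height_function V E r h H))
     \<or>
     (\<exists>g::nat. Q3 V E r \<and> girth E = enat g \<and> g \<ge> 3 \<and>
        (\<exists>h m. admissible_choice V E h m \<and>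
          (\<forall>u\<in>V.
             h (qm E m u) > h u \<and>
             h (m (qm E m u)) > h (m u) \<and>
             h ((qm E m ^^ (nat \<lceil>(real g - 1) / 2\<rceil> + 1)) u) > h (m u))))
     \<or>
     (\<exists>g::nat. Q3 V E r \<and> girth E = enat g \<and> g \<ge> 3 \<and>
        (\<exists>h m. harmonic V E h \<and> admissible_choice V E h m \<and>
          (\<forall>u\<in>V.
             max_incr h m (m u) - max_incr h m u
               < min (max_incr h m u) (max_incr h m (qm E m u)) \<and>
             h ((qm E m ^^ (nat \<lceil>(real g - 1) / 2\<rceil> + 1)) u) > h (m u))))"
  shows "connective_constant V E \<ge> (1 + sqrt 5) / 2"
proof -
  have Q3I: "Q3 V E r" if "G3 V E r"
    using that acts_transitively_imp_one_orbit by (auto simp: G3_def Q3_def)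
  have "Q3 V E r \<and> (\<exists>h m. ascending_choice V E h m)"
    using assms
  proof (elim disjE exE conjE)
    fix h :: "'a \<Rightarrow> int" and H
    assume "G3 V E r" "transitive_graph_height_function V E r h H"
    then show ?thesis using Q3I transitive_height_ascending_choice[of V E r h H] by simp
  next
    fix g :: nat and h m
    assume "Q3 V E r" "admissible_choice V E h m"
      "\<forall>u\<in>V. h u < h (qm E m u) \<and> h (m u) < h (m (qm E m u)) \<and>
        h (m u) < h ((qm E m ^^ (nat \<lceil>(real g - 1) / 2\<rceil> + 1)) u)"
    \<comment> \<open>The first two inequalities are the assumptions of the locale as they
      stand.\<close>
    then have "ascending_choice V E h m" by (simp add: Q3_def ascending_choice_def)
    with \<open>Q3 V E r\<close> show ?thesis by blast
  next
    fix h m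
    assume "Q3 V E r" "harmonic V E h" "admissible_choice V E h m"
      "\<forall>u\<in>V. max_incr h m (m u) - max_incr h m u
          < min (max_incr h m u) (max_incr h m (qm E m u)) \<and>
        2 * max_incr h m (qm E m u)
          > max_incr h m (m u) - max_incr h m u + max_incr h m (m (qm E m u))"
    then have "ascending_choice V E h m"
      by (intro harmonic_ascending_choice) (simp_all add: Q3_def)
    with \<open>Q3 V E r\<close> show ?thesis by blast
  next
    fix g :: nat and h m
    assume "Q3 V E r" "harmonic V E h" "admissible_choice V E h m"
      "\<forall>u\<in>V. max_incr h m (m u) - max_incr h m u
          < min (max_incr h m u) (max_incr h m (qm E m u)) \<and>
        h (m u) < h ((qm E m ^^ (nat \<lceil>(real g - 1) / 2\<rceil> + 1)) u)"
    then have "ascending_choice V E h m"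
      by (intro harmonic_ascending_choice) (simp_all add: Q3_def)
    with \<open>Q3 V E r\<close> show ?thesis by blast
  qed
  then obtain h m where "Q3 V E r" "ascending_choice V E h m" by blast
  then show ?thesis by (intro ascending_choice.connective_constant_ge_golden_mean)
qed

end
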